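(* Let $\mathfrak{A}$ be a finite family of multi-families of subsets of $X=X_1\uplus\cdots\uplus X_M$ such that (a) the set $\mu(\mathfrak{A}(\mathcal{L}))$ does not depend on the product-permutation $\mathcal{L}$, and (b) for every multiset $I$ on $\pi_M$, $T(I)\in\mu(\mathfrak{A}(\mathcal{L}))$ implies $S(I)\in\mu(\mathfrak{A})$. Then $$\varepsilon(\mu(\mathfrak{A}))=\varepsilon\big(\{S(I): I\text{ a multiset on }\pi_M,\ T(I)\in\mu(\mathfrak{A}(\mathcal{L}))\}\big).$$ Consequently, among the maximum size elements of $\mathfrak{A}$ there are homogeneous ones, and the profile matrices of the maximum size elements of $\mathfrak{A}$ are convex linear combinations of the profile matrices of homogeneous maximum size elements of $\mathfrak{A}$.
   Context: $X$ is a finite set partitioned as $X=X_1\uplus\cdots\uplus X_M$, $|X_i|=m_i\ge1$, $n_i=m_i+1$, $[n]^{\star}=\{0,\ldots,n-1\}$, $\pi_M=\prod_i[n_i]^{\star}$. A multi-family is a multiset of subsets of $X$; its size is its cardinality counted with multiplicity. It is homogeneous if the multiplicity of every $F\subseteq X$ depends only on $(|F\cap X_1|,\ldots,|F\cap X_M|)$. Its profile matrix $\mathcal{P}(\mathcal{F})$ has $(i_1,\ldots,i_M)$ entry equal to the number of members (with multiplicity) $F$ with $|F\cap X_j|=i_j$ for all $j$, viewed as a point of $\mathbb{R}^{N}$, $N=\prod_jn_j$. $\mu(\mathfrak{A})=\{\mathcal{P}(\mathcal{F}):\mathcal{F}\in\mathfrak{A}\}$; for a finite point set $\alpha$, $\varepsilon(\alpha)$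 denotes the set of extreme points of its convex hull. A product-permutation $\mathcal{L}$ is a choice of a linear ordering of each $X_j$; $H\subseteq X$ is initial with respect to $\mathcal{L}$ if each $H\cap X_j$ consists of the first $|H\cap X_j|$ elements of $X_j$. $\mathcal{H}(\mathcal{L})$ keeps the members of $\mathcal{H}$ initial with respect to $\mathcal{L}$, with multiplicities; $\mathfrak{A}(\mathcal{L})=\{\mathcal{H}(\mathcal{L}):\mathcal{H}\in\mathfrak{A}\}$. For a multiset $I$ on $\pi_M$, $T(I)$ is the matrix indexed by $\pi_M$ with entry $t_{i_1,\ldots,i_M}(I)$ = multiplicity of $(i_1,\ldots,i_M)$ in $I$, and $S(I)$ has entries $t_{i_1,\ldots,i_M}(I)\prod_j\binom{m_j}{i_j}$. *)

theory Defs
  imports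
    "HOL-Analysis.Analysis"
    "HOL-Analysis.Finite_Function_Topology"
    "HOL-Combinatorics.Multiset_Permutations"
    "HOL-Library.Disjoint_Sets"
begin

text \<open>
  The ground set is \<open>X = P 1 \<union> \<dots> \<union> P M\<close>, a disjoint union of nonempty parts.  The parts are
  indexed by \<open>{1..M}\<close>; values of \<open>P\<close> at other arguments are never used.
\<close>

definition parts_of :: "'a set \<Rightarrow> nat \<Rightarrow> (nat \<Rightarrow> 'a set) \<Rightarrow> bool" where
  "parts_of X M P \<longleftrightarrow>
     finite X \<and> X = (\<Union>j\<in>{1..M}. P j) \<and> disjoint_family_on P {1..M} \<and> (\<forall>j\<in>{1..M}. P j \<noteq> {})"

text \<open>
  The index set \<open>\<pi>\<^sub>M = [n\<^sub>1]\<^sup>\<star> \<times> \<dots> \<times> [n\<^sub>M]\<^sup>\<star>\<close> with \<open>n\<^sub>j = card (P j) + 1\<close>; an index is a function on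
  \<open>{1..M}\<close>, extended by \<open>undefined\<close>.
\<close>

definition index_set :: "nat \<Rightarrow> (nat \<Rightarrow> 'a set) \<Rightarrow> (nat \<Rightarrow> nat) set" where
  "index_set M P = (\<Pi>\<^sub>E j\<in>{1..M}. {0..<card (P j) + 1})"

text \<open>
  Points of \<open>\<real>\<^sup>N\<close>, with coordinates labelled by \<open>\<pi>\<^sub>M\<close>, are represented as finitely supported functions
  vanishing outside \<open>\<pi>\<^sub>M\<close>.  These form a linear subspace isomorphic to \<open>\<real>\<^sup>N\<close>, and convex hulls and
  extreme points do not depend on the ambient vector space.
\<close>

type_synonym pmatrix = "(nat \<Rightarrow> nat) \<Rightarrow>\<^sub>0 real"

definition matrix_of :: "nat \<Rightarrow> (nat \<Rightarrow> 'a set) \<Rightarrow> ((nat \<Rightarrow> nat) \<Rightarrow> nat) \<Rightarrow> pmatrix" where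
  "matrix_of M P f = (\<Sum>i\<in>index_set M P. Poly_Mapping.single i (real (f i)))"

lemma finite_index_set [simp]: "finite (index_set M P)"
  unfolding index_set_def by (rule finite_PiE) auto

lemma lookup_matrix_of:
  "Poly_Mapping.lookup (matrix_of M P f) i = (if i \<in> index_set M P then real (f i) else 0)"
  unfolding matrix_of_def lookup_sum
  by (simp add: lookup_single when_def)

definition multi_family_on :: "'a set \<Rightarrow> 'a set multiset \<Rightarrow> bool" where
  "multi_family_on X H \<longleftrightarrow> (\<forall>F\<in>#H. F \<subseteq> X)"

definition homogeneous :: "'a set \<Rightarrow> nat \<Rightarrow> (nat \<Rightarrow> 'a set) \<Rightarrow> 'a set multiset \<Rightarrow> bool" where
  "homogeneous X M P H \<longleftrightarrow>
     (\<forall>F G. F \<subseteq> X \<longrightarrow> G \<subseteq> X \<longrightarrow> (\<forall>j\<in>{1..M}. card (F \<inter> P j) = card (G \<inter> P j)) \<longrightarrow>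
        count H F = count H G)"

definition profile :: "nat \<Rightarrow> (nat \<Rightarrow> 'a set) \<Rightarrow> 'a set multiset \<Rightarrow> pmatrix" where
  "profile M P H =
     matrix_of M P (\<lambda>i. size (filter_mset (\<lambda>F. \<forall>j\<in>{1..M}. card (F \<inter> P j) = i j) H))"

definition profiles :: "nat \<Rightarrow> (nat \<Rightarrow> 'a set) \<Rightarrow> 'a set multiset set \<Rightarrow> pmatrix set" where
  "profiles M P A = profile M P ` A"

definition extreme_points :: "'v::real_vector set \<Rightarrow> 'v set" where
  "extreme_points S = {x. x extreme_point_of (convex hull S)}"

text \<open>
  A linear ordering of the finite set \<open>P j\<close> is given by listing its elements in increasing order.
\<close>

definition product_permutations :: "nat \<Rightarrow> (nat \<Rightarrow> 'a set) \<Rightarrow> (nat \<Rightarrow> 'a list) set" where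
  "product_permutations M P = (\<Pi>\<^sub>E j\<in>{1..M}. permutations_of_set (P j))"

definition initial_wrt :: "nat \<Rightarrow> (nat \<Rightarrow> 'a set) \<Rightarrow> (nat \<Rightarrow> 'a list) \<Rightarrow> 'a set \<Rightarrow> bool" where
  "initial_wrt M P L F \<longleftrightarrow> (\<forall>j\<in>{1..M}. F \<inter> P j = set (take (card (F \<inter> P j)) (L j)))"

definition initial_part ::
    "nat \<Rightarrow> (nat \<Rightarrow> 'a set) \<Rightarrow> (nat \<Rightarrow> 'a list) \<Rightarrow> 'a set multiset \<Rightarrow> 'a set multiset" where
  "initial_part M P L H = filter_mset (initial_wrt M P L) H"

definition initial_parts ::
    "nat \<Rightarrow> (nat \<Rightarrow> 'a set) \<Rightarrow> (nat \<Rightarrow> 'a list) \<Rightarrow> 'a set multiset set \<Rightarrow> 'a set multiset set" where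
  "initial_parts M P L A = initial_part M P L ` A"

definition multisets_on_index :: "nat \<Rightarrow> (nat \<Rightarrow> 'a set) \<Rightarrow> (nat \<Rightarrow> nat) multiset set" where
  "multisets_on_index M P = {I. set_mset I \<subseteq> index_set M P}"

definition T_matrix :: "nat \<Rightarrow> (nat \<Rightarrow> 'a set) \<Rightarrow> (nat \<Rightarrow> nat) multiset \<Rightarrow> pmatrix" where
  "T_matrix M P I = matrix_of M P (count I)"

definition S_matrix :: "nat \<Rightarrow> (nat \<Rightarrow> 'a set) \<Rightarrow> (nat \<Rightarrow> nat) multiset \<Rightarrow> pmatrix" where
  "S_matrix M P I = matrix_of M P (\<lambda>i. count I i * (\<Prod>j\<in>{1..M}. card (P j) choose i j))"

definition max_size_elements :: "'a set multiset set \<Rightarrow> 'a set multiset set" where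
  "max_size_elements A = {H \<in> A. \<forall>G\<in>A. size G \<le> size H}"

end

theory Submission
  imports Defs
begin

text \<open>
  A set \<open>F\<close> of shape \<open>i\<close> is initial for \<open>\<Prod> i\<^sub>j! (m\<^sub>j - i\<^sub>j)!\<close> of the \<open>\<Prod> m\<^sub>j!\<close> product-permutations, so
  the profile of \<open>H\<close> is the average over \<open>L\<close> of the matrices \<open>S(I\<^sub>L)\<close>, where \<open>I\<^sub>L\<close> is the multiset of
  shapes of \<open>H(L)\<close>.  By (a) and (b) these matrices are themselves profiles, hence the two hulls agree.
  If \<open>H\<close> has maximum size, then so do the families behind all the \<open>S(I\<^sub>L)\<close>, since the size is a
  linear function of the profile; if moreover the profile of \<open>H\<close> is an extreme point, then all
  \<open>S(I\<^sub>L)\<close> coincide.  As \<open>H(L)\<close> contains at most one set of each shape, up to multiplicity, and every set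
  is initial for some \<open>L\<close>, this forces \<open>H\<close> itself to be homogeneous.  (Condition (b) alone only
  provides some family with a homogeneous-looking profile.)
\<close>

section \<open>Extreme points of hulls of finite sets\<close>

text \<open>Minkowski's theorem for finite sets, in a general real vector space because
  \<open>pmatrix\<close> is not a euclidean space. Points lying in the hull of the others are
  discarded one by one; once no such point is left, every remaining point is extreme.\<close>

lemma convex_hull_extreme_points_finite:
  fixes S :: "'v::real_vector set"
  assumes "finite S"
  shows "convex hull {x. x extreme_point_of (convex hull S)} = convex hull S"
  using assms
proof (induction S rule: finite_psubset_induct)
  case (psubset S)
  show ?case
  proof (cases "\<exists>a\<in>S. a \<in> convex hull (S - {a})")
    case True
    then obtain a where a: "a \<in> S" "a \<in> convex hull (S - {a})" by blast
    have "convex hull (S - {a}) = convex hull S"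
      using a hull_redundant[of a convex "S - {a}"] by (simp add: insert_absorb)
    with psubset.IH[of "S - {a}"] a show ?thesis by auto
  next
    case False
    have "{x. x extreme_point_of (convex hull S)} = S"
    proof
      show "{x. x extreme_point_of (convex hull S)} \<subseteq> S"
        by (rule extreme_points_of_convex_hull)
      show "S \<subseteq> {x. x extreme_point_of (convex hull S)}"
      proof
        fix a assume "a \<in> S"
        with False psubset.hyps extreme_point_of_convex_hull_insert[of "S - {a}" a]
        show "a \<in> {x. x extreme_point_of (convex hull S)}" by (simp add: insert_absorb)
      qed
    qed
    then show ?thesis by simp
  qed
qed

text \<open>Dropping the terms equal to \<open>x\<close> leaves the average unchanged. The remaining
  points lie in \<open>C - {x}\<close>, which is convex because \<open>x\<close> is extreme, so
  their average cannot be \<open>x\<close>.\<close>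

lemma extreme_point_eq_average:
  fixes x :: "'v::real_vector"
  assumes "convex C" "x extreme_point_of C" "finite J"
    and y: "\<And>j. j \<in> J \<Longrightarrow> y j \<in> C"
    and avg: "(\<Sum>j\<in>J. y j) = real (card J) *\<^sub>R x"
    and "j \<in> J"
  shows "y j = x"
proof (rule ccontr)
  assume "y j \<noteq> x"
  define K where "K = {j\<in>J. y j \<noteq> x}"
  have K: "finite K" "K \<subseteq> J" "K \<noteq> {}"
    using assms(3,6) \<open>y j \<noteq> x\<close> by (auto simp: K_def)
  then have card: "real (card K) > 0" by (simp add: card_gt_0_iff)
  have "(\<Sum>j\<in>J. y j - x) = 0"
    using avg by (simp add: sum_subtractf sum_constant_scaleR)
  moreover have "(\<Sum>j\<in>K. y j - x) = (\<Sum>j\<in>J. y j - x)"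
    using assms(3) by (intro sum.mono_neutral_left) (auto simp: K_def)
  ultimately have "(\<Sum>j\<in>K. y j) = real (card K) *\<^sub>R x"
    by (simp add: sum_subtractf sum_constant_scaleR)
  then have "(\<Sum>j\<in>K. (1 / real (card K)) *\<^sub>R y j) = x"
    using card by (simp flip: scaleR_sum_right)
  moreover have "(\<Sum>j\<in>K. (1 / real (card K)) *\<^sub>R y j) \<in> C - {x}"
  proof (rule convex_sum)
    show "convex (C - {x})"
      using assms(1,2) by (simp add: extreme_point_of_stillconvex)
  qed (use K card y in \<open>auto simp: K_def\<close>)
  ultimately show False by simp
qed

section \<open>Counting the product-permutations with a given initial set\<close>

text \<open>Such an ordering is an ordering of \<open>B\<close> followed by one of
  \<open>A - B\<close>. The splitting is unique because its first block has length
  \<open>card B\<close>.\<close>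

lemma card_permutations_of_set_initial:
  assumes "finite A" "B \<subseteq> A"
  shows "card {xs \<in> permutations_of_set A. B = set (take (card B) xs)} =
           fact (card B) * fact (card A - card B)"
proof -
  have B: "finite B" using assms finite_subset by blast
  let ?f = "\<lambda>(xs, ys). xs @ ys"
  have "{xs \<in> permutations_of_set A. B = set (take (card B) xs)} =
          ?f ` (permutations_of_set B \<times> permutations_of_set (A - B))" (is "?l = ?r")
  proof
    show "?l \<subseteq> ?r"
    proof
      fix xs assume "xs \<in> ?l"
      then have xs: "set xs = A" "distinct xs" "set (take (card B) xs) = B"
        by (auto dest: permutations_of_setD)
      let ?u = "take (card B) xs" and ?v = "drop (card B) xs"
      have "set ?u \<union> set ?v = A"
        using xs(1) by (metis append_take_drop_id set_append)
      moreover have "distinct ?v" "set ?u \<inter> set ?v = {}"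
        using xs(2) by (metis append_take_drop_id distinct_append)+
      ultimately have "set ?v = A - B" "distinct ?v" using xs(3) by auto
      then have "(?u, ?v) \<in> permutations_of_set B \<times> permutations_of_set (A - B)"
        using xs by auto
      then show "xs \<in> ?r" by (force intro!: image_eqI[of _ _ "(?u, ?v)"])
    qed
    show "?r \<subseteq> ?l"
    proof
      fix zs assume "zs \<in> ?r"
      then obtain xs ys where z: "zs = xs @ ys"
          "set xs = B" "distinct xs" "set ys = A - B" "distinct ys"
        unfolding permutations_of_set_def by auto
      moreover have "length xs = card B" using z distinct_card by metis
      ultimately show "zs \<in> ?l" using assms by (auto simp: permutations_of_set_def)
    qed
  qed
  moreover have "inj_on ?f (permutations_of_set B \<times> permutations_of_set (A - B))"
    by (auto intro!: inj_onI dest: permutations_of_setD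
          simp: length_finite_permutations_of_set)
  ultimately show ?thesis
    using assms B by (simp add: card_image card_cartesian_product card_Diff_subset)
qed

lemma parts_of_subset: "parts_of X M P \<Longrightarrow> j \<in> {1..M} \<Longrightarrow> P j \<subseteq> X"
  unfolding parts_of_def by blast

lemma parts_of_finite: "parts_of X M P \<Longrightarrow> j \<in> {1..M} \<Longrightarrow> finite (P j)"
  using parts_of_subset finite_subset unfolding parts_of_def by metis

lemma finite_product_permutations:
  "finite (product_permutations M P)"
  unfolding product_permutations_def by (intro finite_PiE) auto

lemma card_product_permutations:
  assumes "parts_of X M P"
  shows "card (product_permutations M P) = (\<Prod>j\<in>{1..M}. fact (card (P j)))"
  unfolding product_permutations_def
  using parts_of_finite[OF assms] by (simp add: card_PiE)

text \<open>The restriction to \<open>{1..M}\<close> makes shapes extensional, hence elements of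
  \<open>index_set\<close> that can be compared by equality.\<close>

definition shape :: "nat \<Rightarrow> (nat \<Rightarrow> 'a set) \<Rightarrow> 'a set \<Rightarrow> nat \<Rightarrow> nat" where
  "shape M P F = (\<lambda>j\<in>{1..M}. card (F \<inter> P j))"

lemma shape_in_index_set:
  assumes "parts_of X M P"
  shows "shape M P F \<in> index_set M P"
  using parts_of_finite[OF assms]
  by (auto simp: shape_def index_set_def less_Suc_eq_le intro!: card_mono)

text \<open>Being initial is a separate condition on each \<open>L j\<close>, so the set counted is
  a product over the parts.\<close>

lemma card_initial_wrt:
  assumes "parts_of X M P"
  shows "card {L \<in> product_permutations M P. initial_wrt M P L F} =
           (\<Prod>j\<in>{1..M}. fact (shape M P F j) * fact (card (P j) - shape M P F j))"
proof -
  let ?Q = "\<lambda>j. {xs \<in> permutations_of_set (P j).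
                   F \<inter> P j = set (take (card (F \<inter> P j)) xs)}"
  have "{L \<in> product_permutations M P. initial_wrt M P L F} = (\<Pi>\<^sub>E j\<in>{1..M}. ?Q j)"
    unfolding product_permutations_def initial_wrt_def PiE_def Pi_def by auto
  moreover have "card (?Q j) = fact (shape M P F j) * fact (card (P j) - shape M P F j)"
    if "j \<in> {1..M}" for j
    using card_permutations_of_set_initial[of "P j" "F \<inter> P j"] parts_of_finite[OF assms that] that
    by (simp add: shape_def)
  ultimately show ?thesis by (simp add: card_PiE)
qed

text \<open>On each part this is \<open>k! * (m - k)! * (m choose k) = m!\<close>. It explains the
  binomial weights in \<open>S_matrix\<close>: they make every set count exactly once in the average
  over all product-permutations.\<close>

lemma card_initial_wrt_mult_binomials:
  assumes "parts_of X M P"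
  shows "card {L \<in> product_permutations M P. initial_wrt M P L F} *
           (\<Prod>j\<in>{1..M}. card (P j) choose shape M P F j) = card (product_permutations M P)"
proof -
  have "fact (shape M P F j) * fact (card (P j) - shape M P F j) *
          (card (P j) choose shape M P F j) = (fact (card (P j)) :: nat)"
    if "j \<in> {1..M}" for j
    using that parts_of_finite[OF assms that]
    by (intro binomial_fact_lemma) (auto simp: shape_def intro!: card_mono)
  then show ?thesis
    by (simp add: card_initial_wrt[OF assms] card_product_permutations[OF assms]
          flip: prod.distrib)
qed

lemma ex_initial_wrt:
  assumes "parts_of X M P"
  shows "\<exists>L\<in>product_permutations M P. initial_wrt M P L F"
proof -
  have "card {L \<in> product_permutations M P. initial_wrt M P L F} \<noteq> 0"
    unfolding card_initial_wrt[OF assms] by simp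
  then show ?thesis by (auto simp: card_eq_0_iff)
qed

text \<open>An initial segment of \<open>L j\<close> is determined by its length.\<close>

lemma initial_wrt_unique:
  assumes "parts_of X M P" "F \<subseteq> X" "G \<subseteq> X" "shape M P F = shape M P G"
    and "initial_wrt M P L F" "initial_wrt M P L G"
  shows "F = G"
proof -
  have "F \<inter> P j = G \<inter> P j" if "j \<in> {1..M}" for j
  proof -
    have "card (F \<inter> P j) = card (G \<inter> P j)"
      using fun_cong[OF assms(4), of j] that by (simp add: shape_def)
    then show ?thesis using assms(5,6) that unfolding initial_wrt_def by metis
  qed
  moreover have "F = (\<Union>j\<in>{1..M}. F \<inter> P j)" "G = (\<Union>j\<in>{1..M}. G \<inter> P j)"
    using assms(1-3) unfolding parts_of_def by blast+
  ultimately show ?thesis by auto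
qed

section \<open>Profiles as averages over product-permutations\<close>

text \<open>Applied to an initial part, this is the multiset \<open>I\<close> to which condition (b)
  is applied: its \<open>T_matrix\<close> is the profile of that initial part.\<close>

definition shapes :: "nat \<Rightarrow> (nat \<Rightarrow> 'a set) \<Rightarrow> 'a set multiset \<Rightarrow> (nat \<Rightarrow> nat) multiset" where
  "shapes M P H = image_mset (shape M P) H"

lemma shapes_in_multisets_on_index:
  "parts_of X M P \<Longrightarrow> shapes M P H \<in> multisets_on_index M P"
  using shape_in_index_set by (auto simp: shapes_def multisets_on_index_def)

lemma count_shapes: "count (shapes M P H) i = size {#F \<in># H. shape M P F = i#}"
  unfolding shapes_def by (induction H) auto

lemma shape_eq_iff:
  assumes "i \<in> index_set M P"
  shows "shape M P F = i \<longleftrightarrow> (\<forall>j\<in>{1..M}. card (F \<inter> P j) = i j)"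
  using assms by (auto simp: shape_def index_set_def fun_eq_iff PiE_iff extensional_def)

lemma lookup_profile:
  "Poly_Mapping.lookup (profile M P H) i =
     (if i \<in> index_set M P then real (count (shapes M P H) i) else 0)"
  unfolding profile_def lookup_matrix_of count_shapes
  using shape_eq_iff[of i M P] by simp

lemma T_matrix_shapes: "T_matrix M P (shapes M P H) = profile M P H"
  by (rule poly_mapping_eqI) (simp add: T_matrix_def lookup_matrix_of lookup_profile)

lemma lookup_scaleR [simp]:
  "Poly_Mapping.lookup (r *\<^sub>R p) i = r *\<^sub>R Poly_Mapping.lookup p i"
proof -
  have "finite {i. r *\<^sub>R Poly_Mapping.lookup p i \<noteq> 0}"
    by (rule finite_subset[OF _ finite_lookup[of p]]) auto
  then show ?thesis by (simp add: scaleR_poly_mapping_def Abs_poly_mapping_inverse)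
qed

text \<open>Double counting, one member at a time: a member of shape \<open>i\<close> adds 1 for
  each product-permutation making it initial, and the binomials turn that number into
  \<open>card (product_permutations M P)\<close>.\<close>

lemma sum_count_shapes_initial_part:
  assumes "parts_of X M P"
  shows "(\<Sum>L\<in>product_permutations M P. count (shapes M P (initial_part M P L H)) i) *
           (\<Prod>j\<in>{1..M}. card (P j) choose i j) =
         card (product_permutations M P) * count (shapes M P H) i"
proof (induction H)
  case empty
  show ?case by (simp add: shapes_def initial_part_def)
next
  case (add F H)
  let ?PP = "product_permutations M P"
  have "(\<Sum>L\<in>?PP. count (shapes M P (initial_part M P L (add_mset F H))) i) =
        (\<Sum>L\<in>?PP. count (shapes M P (initial_part M P L H)) i) +
        (\<Sum>L\<in>?PP. if initial_wrt M P L F \<and> shape M P F = i then 1 else 0)"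
    unfolding sum.distrib[symmetric]
    by (intro sum.cong) (auto simp: shapes_def initial_part_def)
  also have "(\<Sum>L\<in>?PP. if initial_wrt M P L F \<and> shape M P F = i then 1 else 0) =
        (if shape M P F = i then card {L\<in>?PP. initial_wrt M P L F} else 0)"
    by (auto simp: finite_product_permutations sum.If_cases Int_def)
  finally show ?case
    using add.IH card_initial_wrt_mult_binomials[OF assms, of F]
    by (auto simp: shapes_def algebra_simps)
qed

lemma sum_S_matrix_initial_part:
  assumes "parts_of X M P"
  shows "(\<Sum>L\<in>product_permutations M P. S_matrix M P (shapes M P (initial_part M P L H))) =
           real (card (product_permutations M P)) *\<^sub>R profile M P H"
proof (rule poly_mapping_eqI)
  fix i
  show "Poly_Mapping.lookup
          (\<Sum>L\<in>product_permutations M P. S_matrix M P (shapes M P (initial_part M P L H))) i =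
        Poly_Mapping.lookup (real (card (product_permutations M P)) *\<^sub>R profile M P H) i"
    using arg_cong[OF sum_count_shapes_initial_part[OF assms, of H i], of real]
    by (simp add: lookup_sum S_matrix_def lookup_matrix_of lookup_profile sum_distrib_right)
qed

text \<open>The linear functional whose value at a profile is the size of the family; it makes
  maximality of size a linear condition on profiles.\<close>

definition entry_sum :: "nat \<Rightarrow> (nat \<Rightarrow> 'a set) \<Rightarrow> pmatrix \<Rightarrow> real" where
  "entry_sum M P p = (\<Sum>i\<in>index_set M P. Poly_Mapping.lookup p i)"

lemma linear_entry_sum: "linear (entry_sum M P)"
  by (rule linearI) (simp_all add: entry_sum_def lookup_add sum.distrib sum_distrib_left)

lemma entry_sum_profile:
  assumes "parts_of X M P"
  shows "entry_sum M P (profile M P H) = real (size H)"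
proof -
  have "(\<Sum>i\<in>index_set M P. count (shapes M P H) i) = size (shapes M P H)"
    using shapes_in_multisets_on_index[OF assms, of H] unfolding size_multiset_overloaded_eq
    by (intro sum.mono_neutral_right) (auto simp: multisets_on_index_def not_in_iff)
  also have "\<dots> = size H" by (simp add: shapes_def)
  finally show ?thesis by (simp add: entry_sum_def lookup_profile flip: of_nat_sum)
qed

section \<open>Homogeneous families\<close>

text \<open>Among the sets of the same shape as \<open>F\<close>, only \<open>F\<close> itself is
  initial, so exactly its copies are counted.\<close>

lemma count_shapes_initial_part:
  assumes "parts_of X M P" "multi_family_on X H" "F \<subseteq> X" "initial_wrt M P L F"
  shows "count (shapes M P (initial_part M P L H)) (shape M P F) = count H F"
proof -
  have "initial_wrt M P L G \<and> shape M P G = shape M P F \<longleftrightarrow> G = F" if "G \<in># H" for G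
    using initial_wrt_unique[OF assms(1) _ assms(3) _ _ assms(4), of G] assms(2,4) that
    unfolding multi_family_on_def by blast
  then have "{#G \<in># initial_part M P L H. shape M P G = shape M P F#} = {#G \<in># H. G = F#}"
    unfolding initial_part_def filter_filter_mset
    by (intro filter_mset_cong) (auto simp: conj_commute)
  then show ?thesis by (simp add: count_shapes filter_eq_replicate_mset)
qed

text \<open>For each \<open>F\<close>, some product-permutation makes \<open>F\<close> initial; the
  entry of \<open>p\<close> at its shape is then \<open>count H F\<close> times the binomial weight.
  Both the entry and the weight depend on the shape only.\<close>

lemma homogeneous_if_S_matrix_const:
  assumes part: "parts_of X M P" and H: "multi_family_on X H"
    and const: "\<And>L. L \<in> product_permutations M P \<Longrightarrow>
      S_matrix M P (shapes M P (initial_part M P L H)) = p"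
  shows "homogeneous X M P H"
proof -
  have count: "Poly_Mapping.lookup p (shape M P F) =
      real (count H F * (\<Prod>j\<in>{1..M}. card (P j) choose shape M P F j))" if F: "F \<subseteq> X" for F
  proof -
    obtain L where L: "L \<in> product_permutations M P" "initial_wrt M P L F"
      using ex_initial_wrt[OF part] by blast
    show ?thesis
      using shape_in_index_set[OF part] count_shapes_initial_part[OF part H F L(2)]
      by (simp add: S_matrix_def lookup_matrix_of flip: const[OF L(1)])
  qed
  show ?thesis
    unfolding homogeneous_def
  proof (intro allI impI)
    fix F G assume FG: "F \<subseteq> X" "G \<subseteq> X" "\<forall>j\<in>{1..M}. card (F \<inter> P j) = card (G \<inter> P j)"
    then have "shape M P F = shape M P G" by (auto simp: shape_def)
    moreover have "(\<Prod>j\<in>{1..M}. card (P j) choose shape M P F j) \<noteq> 0"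
    proof -
      \<comment> \<open>The weight is a factor of this nonzero number, so it can be
        cancelled.\<close>
      have "card (product_permutations M P) \<noteq> 0"
        by (simp add: card_product_permutations[OF part])
      then show ?thesis
        using card_initial_wrt_mult_binomials[OF part, of F] by (metis mult_0_right)
    qed
    ultimately show "count H F = count H G"
      using count[OF FG(1)] count[OF FG(2)] by (auto simp flip: of_nat_mult)
  qed
qed

text \<open>Condition (b) is stated for one fixed \<open>L\<close>; by (a) the set of profiles in it
  is the same for every product-permutation. The existence claim needs \<open>A \<noteq> {}\<close>,
  since an empty family has no maximum size element.\<close>

theorem theorem5p2:
  fixes X :: "'a set" and M :: nat and P :: "nat \<Rightarrow> 'a set"
    and A :: "'a set multiset set" and L :: "nat \<Rightarrow> 'a list"
  assumes partition: "parts_of X M P"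
    and finite_A: "finite A"
    and multi_families: "\<forall>H\<in>A. multi_family_on X H"
    and a: "\<forall>L1\<in>product_permutations M P. \<forall>L2\<in>product_permutations M P.
              profiles M P (initial_parts M P L1 A) = profiles M P (initial_parts M P L2 A)"
    and L: "L \<in> product_permutations M P"
    and b: "\<forall>I\<in>multisets_on_index M P.
              T_matrix M P I \<in> profiles M P (initial_parts M P L A) \<longrightarrow>
              S_matrix M P I \<in> profiles M P A"
  shows "extreme_points (profiles M P A) =
           extreme_points {S_matrix M P I | I. I \<in> multisets_on_index M P \<and>
             T_matrix M P I \<in> profiles M P (initial_parts M P L A)}
       \<and> (A \<noteq> {} \<longrightarrow> (\<exists>H\<in>max_size_elements A. homogeneous X M P H))
       \<and> (\<forall>H\<in>max_size_elements A.
            profile M P H \<in>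
              convex hull (profile M P ` {G \<in> max_size_elements A. homogeneous X M P G}))"
proof -
  let ?PP = "product_permutations M P"
  let ?s = "\<lambda>L H. S_matrix M P (shapes M P (initial_part M P L H))"
  let ?B = "{S_matrix M P I | I. I \<in> multisets_on_index M P \<and>
             T_matrix M P I \<in> profiles M P (initial_parts M P L A)}"
  let ?Max = "max_size_elements A"
  let ?Hom = "{G \<in> ?Max. homogeneous X M P G}"
  have PP: "finite ?PP" "real (card ?PP) > 0"
    using finite_product_permutations L by (auto simp: card_gt_0_iff)
  have s_in_B: "?s L' H \<in> ?B" if "H \<in> A" "L' \<in> ?PP" for H L'
  proof -
    have "T_matrix M P (shapes M P (initial_part M P L' H)) \<in> profiles M P (initial_parts M P L' A)"
      using that(1) by (simp add: T_matrix_shapes profiles_def initial_parts_def)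
    also have "\<dots> = profiles M P (initial_parts M P L A)" using a L that(2) by blast
    finally show ?thesis using shapes_in_multisets_on_index[OF partition] by blast
  qed
  have B_sub: "?B \<subseteq> profiles M P A" using b by blast
  have "profiles M P A \<subseteq> convex hull ?B"
  proof
    fix p assume "p \<in> profiles M P A"
    then obtain H where H: "H \<in> A" "p = profile M P H" by (auto simp: profiles_def)
    have "(\<Sum>L'\<in>?PP. (1 / real (card ?PP)) *\<^sub>R ?s L' H) \<in> convex hull ?B"
      using PP s_in_B[OF H(1)] by (intro convex_sum) (auto intro!: hull_inc)
    also have "(\<Sum>L'\<in>?PP. (1 / real (card ?PP)) *\<^sub>R ?s L' H) = p"
      using PP(2) unfolding scaleR_sum_right[symmetric] sum_S_matrix_initial_part[OF partition]
        scaleR_scaleR H(2)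
      by (simp del: of_nat_0_less_iff)
    finally show "p \<in> convex hull ?B" .
  qed
  with B_sub have "convex hull (profiles M P A) = convex hull ?B"
    by (metis (no_types, lifting) convex_convex_hull hull_minimal hull_mono subset_antisym)
  then have extreme: "extreme_points (profiles M P A) = extreme_points ?B"
    by (simp add: extreme_points_def)

  \<comment> \<open>Extremality is required only in the hull of the maximum size profiles, since all
    matrices averaged below turn out to lie there.\<close>
  have hom: "profile M P H \<in> profile M P ` ?Hom"
    if x: "profile M P H extreme_point_of (convex hull (profile M P ` ?Max))" and H: "H \<in> ?Max" for H
  proof -
    have HA: "H \<in> A" using H by (simp add: max_size_elements_def)
    have le: "entry_sum M P p \<le> real (size H)" if "p \<in> profiles M P A" for p
      using that H entry_sum_profile[OF partition]
      by (auto simp: profiles_def max_size_elements_def)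
    have le': "entry_sum M P (?s L' H) \<le> real (size H)" if "L' \<in> ?PP" for L'
      using le B_sub s_in_B[OF HA that] by blast
    \<comment> \<open>The entry sums are at most \<open>size H\<close> and average to
      \<open>size H\<close>, so each of them equals \<open>size H\<close>.\<close>
    have "(\<Sum>L'\<in>?PP. entry_sum M P (?s L' H)) = (\<Sum>L'\<in>?PP. real (size H))"
      using arg_cong[OF sum_S_matrix_initial_part[OF partition, of H], of "entry_sum M P"]
      by (simp add: linear_sum[OF linear_entry_sum] linear_scale[OF linear_entry_sum]
            entry_sum_profile[OF partition])
    then have "(\<Sum>L'\<in>?PP. real (size H) - entry_sum M P (?s L' H)) = 0"
      by (simp add: sum_subtractf)
    then have eq: "entry_sum M P (?s L' H) = real (size H)" if "L' \<in> ?PP" for L'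
      using that le' PP(1) by (subst (asm) sum_nonneg_eq_0_iff) auto
    have "?s L' H \<in> convex hull (profile M P ` ?Max)" if L': "L' \<in> ?PP" for L'
    proof -
      obtain G where G: "G \<in> A" "?s L' H = profile M P G"
        using s_in_B[OF HA L'] B_sub by (auto simp: profiles_def)
      then have "size G = size H" using eq[OF L'] entry_sum_profile[OF partition, of G] by simp
      then have "G \<in> ?Max" using G H by (simp add: max_size_elements_def)
      then show ?thesis using G by (auto intro: hull_inc)
    qed
    then have "?s L' H = profile M P H" if "L' \<in> ?PP" for L'
      using extreme_point_eq_average[OF convex_convex_hull x PP(1) _ sum_S_matrix_initial_part[OF partition]]
        that by blast
    then have "homogeneous X M P H"
      using homogeneous_if_S_matrix_const[OF partition] multi_families HA by blast
    then show ?thesis using H by blast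
  qed
  have fin: "finite (profile M P ` ?Max)" using finite_A by (simp add: max_size_elements_def)
  \<comment> \<open>Extreme points of the hull are themselves profiles of maximum size elements, so
    \<open>hom\<close> covers all of them; they span the whole hull because \<open>A\<close> is
    finite.\<close>
  have "{x. x extreme_point_of (convex hull (profile M P ` ?Max))} \<subseteq> profile M P ` ?Hom"
    using hom extreme_point_of_convex_hull by blast
  from hull_mono[OF this, of convex]
  have "convex hull (profile M P ` ?Max) \<subseteq> convex hull (profile M P ` ?Hom)"
    by (simp only: convex_hull_extreme_points_finite[OF fin])
  then have hull: "profile M P H \<in> convex hull (profile M P ` ?Hom)" if "H \<in> ?Max" for H
    by (rule subsetD[OF _ hull_inc[OF imageI[OF that]]])
  have "\<exists>H\<in>?Max. homogeneous X M P H" if "A \<noteq> {}"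
  proof -
    have "Max (size ` A) \<in> size ` A" using finite_A that by (intro Max_in) auto
    then obtain H where "Max (size ` A) = size H" "H \<in> A" by (rule imageE)
    then have "H \<in> ?Max"
      using Max_ge[of "size ` A"] finite_A by (auto simp: max_size_elements_def)
    \<comment> \<open>Existence follows from the hull statement, because the hull of the empty set
      is empty.\<close>
    from hull[OF this] have "?Hom \<noteq> {}"
      by (metis convex_hull_empty empty_iff image_empty)
    then show ?thesis by blast
  qed
  with extreme hull show ?thesis by blast
qed

end
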